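(* Let $K$ be a field, $X=\{x_1,\dots,x_n\}$, let $F=(f_1,\dots,f_k)$ be a tuple of polynomials in $K[X]$, let $I\subsetneq K[X]$ be an ideal with $I:\langle f_1\cdots f_k\rangle=I$, and let $L$ be an extension field of $K$. Let $\Lambda$ be the unit lattice with associated character $\rho$ of $F$ modulo $I$ (over $K$), and let $\Lambda'$ be the unit lattice with associated character $\rho'$ of $F$ modulo $IL[X]$ (over $L$). Then $\Lambda=\Lambda'$, and $\rho(a)=\rho'(a)\in K$ for all $a\in\Lambda$.
   Context: For $a\in\mathbb Z^k$ write $a=a^+-a^-$ with $a_i^+=\max\{a_i,0\}$, $a_i^-=\max\{-a_i,0\}$, and $F^b=f_1^{b_1}\cdots f_k^{b_k}$ for $b\in\mathbb N^k$. For a field $E$ and an ideal $J\subsetneq E[X]$ such that the residue classes of $f_1,\dots,f_k$ are non-zerodivisors modulo $J$, the unit lattice of $F$ modulo $J$ (over $E$) is $\{a\in\mathbb Z^k\mid F^{a^+}-g_aF^{a^-}\in J\text{ for some }g_a\in E^\times\}$; the element $g_a$ is unique, and the group homomorphism $a\mapsto g_a$ from the unit lattice to $E^\times$ is the associated character. *)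

theory Defs
  imports "HOL-Analysis.Finite_Cartesian_Product" "HOL-Library.Poly_Mapping"
begin

text \<open>
  The polynomial ring $E[X]$, with the variables indexed by the finite type \<open>'n\<close>: a polynomial
  maps exponent vectors to coefficients, and multiplication is convolution.
\<close>

type_synonym ('n, 'a) mpoly = "('n \<Rightarrow>\<^sub>0 nat) \<Rightarrow>\<^sub>0 'a"

abbreviation Const :: "'a::zero \<Rightarrow> ('n, 'a) mpoly" where
  "Const c \<equiv> Poly_Mapping.single 0 c"

text \<open>Ideals of a commutative ring are its submodules as a module over itself.\<close>

abbreviation is_ideal :: "'r::comm_ring_1 set \<Rightarrow> bool" where
  "is_ideal \<equiv> module.subspace (*)"

abbreviation ideal_generated :: "'r::comm_ring_1 set \<Rightarrow> 'r set" where
  "ideal_generated \<equiv> module.span (*)"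

definition ideal_quotient :: "'r::comm_ring_1 set \<Rightarrow> 'r set \<Rightarrow> 'r set" where
  "ideal_quotient I J = {g. \<forall>h\<in>J. g * h \<in> I}"

text \<open>The residue class of \<open>f\<close> is a non-zerodivisor in the quotient ring modulo \<open>J\<close>.\<close>

definition nonzerodivisor_mod :: "'r::comm_ring_1 set \<Rightarrow> 'r \<Rightarrow> bool" where
  "nonzerodivisor_mod J f \<longleftrightarrow> (\<forall>g. f * g \<in> J \<longrightarrow> g \<in> J)"

definition pos_part :: "int ^ 'k \<Rightarrow> nat ^ 'k" where
  "pos_part a = (\<chi> i. nat (max (a $ i) 0))"

definition neg_part :: "int ^ 'k \<Rightarrow> nat ^ 'k" where
  "neg_part a = (\<chi> i. nat (max (- (a $ i)) 0))"

definition tuple_power :: "'r::comm_monoid_mult ^ 'k::finite \<Rightarrow> nat ^ 'k \<Rightarrow> 'r" where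
  "tuple_power F b = (\<Prod>i\<in>UNIV. (F $ i) ^ (b $ i))"

text \<open>
  The standing assumptions under which unit lattice and character of \<open>F\<close> modulo \<open>J\<close> are
  considered. The definitions of the latter below are total; the character is only
  meaningful on the unit lattice and under these assumptions, which make \<open>g\<close> unique.
\<close>

definition admits_unit_lattice ::
    "('n, 'a::field) mpoly set \<Rightarrow> ('n, 'a) mpoly ^ 'k::finite \<Rightarrow> bool" where
  "admits_unit_lattice J F \<longleftrightarrow>
     is_ideal J \<and> J \<noteq> UNIV \<and> (\<forall>i. nonzerodivisor_mod J (F $ i))"

definition unit_lattice ::
    "('n, 'a::field) mpoly set \<Rightarrow> ('n, 'a) mpoly ^ 'k::finite \<Rightarrow> (int ^ 'k) set" where
  "unit_lattice J F =
     {a. \<exists>g. g \<noteq> 0 \<and>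
           tuple_power F (pos_part a) - Const g * tuple_power F (neg_part a) \<in> J}"

definition unit_character ::
    "('n, 'a::field) mpoly set \<Rightarrow> ('n, 'a) mpoly ^ 'k::finite \<Rightarrow> int ^ 'k \<Rightarrow> 'a" where
  "unit_character J F a =
     (THE g. g \<noteq> 0 \<and>
           tuple_power F (pos_part a) - Const g * tuple_power F (neg_part a) \<in> J)"

text \<open>
  Extension fields are represented by field homomorphisms \<open>\<phi>\<close> from \<open>K\<close> to \<open>L\<close>, which are
  automatically injective. The following map is the induced embedding of $K[X]$ into $L[X]$,
  which applies \<open>\<phi>\<close> to all coefficients.
\<close>

definition field_embedding :: "('a::field \<Rightarrow> 'b::field) \<Rightarrow> bool" where
  "field_embedding \<phi> \<longleftrightarrow>
     \<phi> 1 = 1 \<and> (\<forall>x y. \<phi> (x + y) = \<phi> x + \<phi> y) \<and> (\<forall>x y. \<phi> (x * y) = \<phi> x * \<phi> y)"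

abbreviation extend_poly :: "('a::zero \<Rightarrow> 'b::zero) \<Rightarrow> ('n, 'a) mpoly \<Rightarrow> ('n, 'b) mpoly" where
  "extend_poly \<phi> \<equiv> Poly_Mapping.map \<phi>"

definition extend_tuple ::
    "('a::zero \<Rightarrow> 'b::zero) \<Rightarrow> ('n, 'a) mpoly ^ 'k \<Rightarrow> ('n, 'b) mpoly ^ 'k" where
  "extend_tuple \<phi> F = (\<chi> i. extend_poly \<phi> (F $ i))"

definition extend_ideal ::
    "('a::field \<Rightarrow> 'b::field) \<Rightarrow> ('n, 'a) mpoly set \<Rightarrow> ('n, 'b) mpoly set" where
  "extend_ideal \<phi> I = ideal_generated (extend_poly \<phi> ` I)"

end

theory Submission
  imports Defs
begin

text \<open>
  Regard \<open>L\<close> as a vector space over \<open>K\<close> by way of \<open>\<phi>\<close>. A $K$-linear functional $\lambda\colon L \to K$,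
  applied to all coefficients, is a map $\lambda_*\colon L[X] \to K[X]$ that is linear over $K[X]$.
  The proof rests on the fact that such maps detect the extended ideal: \<open>h\<close> lies in $I L[X]$ if and
  only if $\lambda_* h \in I$ for every functional (\<open>mem_extend_ideal_iff\<close>). One direction is
  linearity over $K[X]$; for the other, expand the coefficients of \<open>h\<close> in a $K$-basis of \<open>L\<close> and
  observe that the components of \<open>h\<close> are the polynomials $\lambda_* h$ for the coordinate
  functionals $\lambda$.

  By this criterion, a polynomial that is a non-zerodivisor modulo \<open>I\<close> stays one modulo
  $I L[X]$. Choosing a basis that contains 1 gives a functional with $\lambda(1) = 1$. Applied to the
  constant 1 it shows that $I L[X]$ is proper, and applied to
  $F^{a^+} - g F^{a^-} \in I L[X]$ with $g \in L$ it gives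
  $F^{a^+} - \lambda(g) F^{a^-} \in I$. A relation of this form determines its scalar and forces it to
  be nonzero, because the powers of \<open>F\<close> are non-zerodivisors modulo a proper ideal. Hence \<open>a\<close>
  belongs to the lattice over \<open>K\<close>, and $g = \phi(\lambda(g))$.
\<close>

interpretation ideal: module "(*) :: 'r::comm_ring_1 \<Rightarrow> 'r \<Rightarrow> 'r"
  by unfold_locales (simp_all add: algebra_simps)

section \<open>Applying additive maps to coefficients\<close>

lemma lookup_map_zero:
  assumes "f 0 = 0"
  shows "Poly_Mapping.lookup (Poly_Mapping.map f p) k = f (Poly_Mapping.lookup p k)"
  using assms by (simp add: map.rep_eq when_def)

lemma map_zero_poly_mapping: "Poly_Mapping.map f 0 = 0"
  by (rule poly_mapping_eqI) (simp add: map.rep_eq)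

lemma map_one_poly_mapping: "f 0 = 0 \<Longrightarrow> Poly_Mapping.map f 1 = Poly_Mapping.single 0 (f 1)"
  by (subst single_one[symmetric]) (simp del: single_one)

lemma map_poly_mapping_id: "Poly_Mapping.map (\<lambda>x. x) p = p"
  by (rule poly_mapping_eqI) (simp add: lookup_map_zero)

lemma map_add_poly_mapping:
  assumes "additive f"
  shows "Poly_Mapping.map f (p + q) = Poly_Mapping.map f p + Poly_Mapping.map f q"
  by (rule poly_mapping_eqI)
    (simp add: lookup_map_zero lookup_add additive.zero[OF assms] additive.add[OF assms])

lemma map_diff_poly_mapping:
  assumes "additive f"
  shows "Poly_Mapping.map f (p - q) = Poly_Mapping.map f p - Poly_Mapping.map f q"
  by (rule poly_mapping_eqI)
    (simp add: lookup_map_zero lookup_minus additive.zero[OF assms] additive.diff[OF assms])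

lemma poly_mapping_additive_induct [case_names zero single add]:
  fixes p :: "'m \<Rightarrow>\<^sub>0 'a::monoid_add"
  assumes "P 0" and "\<And>k c. P (Poly_Mapping.single k c)" and "\<And>p q. P p \<Longrightarrow> P q \<Longrightarrow> P (p + q)"
  shows "P p"
proof (induction p rule: update_induct)
  case const
  show ?case by (rule assms(1))
next
  case (update f a b)
  have "Poly_Mapping.update a b f = f + Poly_Mapping.single a b"
    using update.hyps
    by (intro poly_mapping_eqI) (auto simp: lookup_update lookup_add lookup_single in_keys_iff when_def)
  with update.IH show ?case by (simp add: assms)
qed

lemma additive_ident: "additive (\<lambda>x. x)"
  by (rule additive.intro) (rule refl)

text \<open>
  The convolution product is biadditive, so an identity between products of coefficients passes
  to polynomials. The four maps cover three cases: the multiplicativity of the extension map, the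
  linearity over $K[X]$ of a functional applied to coefficients, and multiplication by a constant.
\<close>

lemma map_mult_poly_mapping:
  fixes p :: "'m::monoid_add \<Rightarrow>\<^sub>0 'a::ring" and q :: "'m \<Rightarrow>\<^sub>0 'b::ring"
    and \<alpha> :: "'a \<Rightarrow> 'b" and h :: "'b \<Rightarrow> 'c::ring"
  assumes additive: "additive h" "additive \<alpha>" "additive \<beta>" "additive \<gamma>"
    and mult: "\<And>c x. h (\<alpha> c * x) = \<beta> c * \<gamma> x"
  shows "Poly_Mapping.map h (Poly_Mapping.map \<alpha> p * q)
    = Poly_Mapping.map \<beta> p * Poly_Mapping.map \<gamma> q"
proof (induction p rule: poly_mapping_additive_induct)
  case zero
  show ?case by (simp add: map_zero_poly_mapping)
next
  case (add p p')
  then show ?case by (simp add: map_add_poly_mapping additive distrib_right)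
next
  case (single k c)
  note zero = additive[THEN additive.zero]
  show ?case
  proof (induction q rule: poly_mapping_additive_induct)
    case zero
    show ?case by (simp add: map_zero_poly_mapping)
  next
    case (add q q')
    then show ?case by (simp add: map_add_poly_mapping additive distrib_left)
  next
    case (single l x)
    show ?case by (simp add: zero mult mult_single)
  qed
qed

lemma Const_mult_eq_map:
  fixes q :: "('n, 'a::comm_ring_1) mpoly"
  shows "Const b * q = Poly_Mapping.map ((*) b) q"
proof -
  have "additive ((*) b)"
    by (rule additive.intro) (rule distrib_left)
  moreover note additive_ident
  moreover have "b * (c * x) = b * c * x" for c x
    by (rule mult.assoc[symmetric])
  ultimately have "Poly_Mapping.map ((*) b) (Poly_Mapping.map (\<lambda>x. x) 1 * q)
      = Poly_Mapping.map ((*) b) 1 * Poly_Mapping.map (\<lambda>x. x) q"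
    by (intro map_mult_poly_mapping)
  then show ?thesis by (simp add: map_poly_mapping_id map_one_poly_mapping)
qed

lemma lookup_Const_mult:
  fixes q :: "('n, 'a::comm_ring_1) mpoly"
  shows "Poly_Mapping.lookup (Const b * q) k = b * Poly_Mapping.lookup q k"
  by (simp add: Const_mult_eq_map lookup_map_zero)

section \<open>Extension of scalars\<close>

lemma field_embedding_additive: "field_embedding \<phi> \<Longrightarrow> additive \<phi>"
  by (simp add: field_embedding_def additive_def)

lemma extend_poly_one:
  assumes "field_embedding \<phi>"
  shows "extend_poly \<phi> 1 = 1"
  using assms additive.zero[OF field_embedding_additive[OF assms]]
  by (simp add: field_embedding_def map_one_poly_mapping)

lemma extend_poly_mult:
  fixes p q :: "('n, 'a::field) mpoly"
  assumes "field_embedding \<phi>"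
  shows "extend_poly \<phi> (p * q) = extend_poly \<phi> p * extend_poly \<phi> q"
proof -
  have "\<phi> (c * x) = \<phi> c * \<phi> x" for c x
    using assms by (simp add: field_embedding_def)
  with field_embedding_additive[OF assms] additive_ident
  have "extend_poly \<phi> (Poly_Mapping.map (\<lambda>x. x) p * q) = extend_poly \<phi> p * extend_poly \<phi> q"
    by (intro map_mult_poly_mapping)
  then show ?thesis by (simp only: map_poly_mapping_id)
qed

lemma extend_poly_tuple_power:
  fixes F :: "('n, 'a::field) mpoly ^ 'k::finite"
  assumes "field_embedding \<phi>"
  shows "tuple_power (extend_tuple \<phi> F) b = extend_poly \<phi> (tuple_power F b)"
proof -
  have power: "extend_poly \<phi> (p ^ m) = extend_poly \<phi> p ^ m" for p :: "('n, 'a) mpoly" and m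
    by (induction m) (simp_all add: extend_poly_one[OF assms] extend_poly_mult[OF assms])
  have "(\<Prod>i\<in>S. extend_poly \<phi> (F $ i) ^ (b $ i)) = extend_poly \<phi> (\<Prod>i\<in>S. (F $ i) ^ (b $ i))"
    if "finite S" for S
    using that
    by (induction S) (simp_all add: power extend_poly_one[OF assms] extend_poly_mult[OF assms])
  then show ?thesis by (simp add: tuple_power_def extend_tuple_def)
qed

definition linear_functional :: "('a::field \<Rightarrow> 'b::field) \<Rightarrow> ('b \<Rightarrow> 'a) \<Rightarrow> bool" where
  "linear_functional \<phi> l \<longleftrightarrow> additive l \<and> (\<forall>c x. l (\<phi> c * x) = c * l x)"

lemma map_functional_mult_extend_poly:
  fixes p :: "('n, 'a::field) mpoly" and q :: "('n, 'b::field) mpoly"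
  assumes \<phi>: "field_embedding \<phi>" and l: "linear_functional \<phi> l"
  shows "Poly_Mapping.map l (extend_poly \<phi> p * q) = p * Poly_Mapping.map l q"
proof -
  have "additive l" and "l (\<phi> c * x) = c * l x" for c x
    using l by (simp_all add: linear_functional_def)
  with field_embedding_additive[OF \<phi>] additive_ident
  have "Poly_Mapping.map l (extend_poly \<phi> p * q)
      = Poly_Mapping.map (\<lambda>x. x) p * Poly_Mapping.map l q"
    by (intro map_mult_poly_mapping)
  then show ?thesis by (simp only: map_poly_mapping_id)
qed

text \<open>
  The coordinate functionals of a $K$-basis of \<open>L\<close> that contains 1. They are indexed by all
  elements of \<open>L\<close>, and those outside the basis carry the zero functional.
\<close>

lemma coordinate_functionals:
  fixes \<phi> :: "'a::field \<Rightarrow> 'b::field"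
  assumes "field_embedding \<phi>"
  obtains r :: "'b \<Rightarrow> 'b \<Rightarrow> 'a"
  where "\<And>b. linear_functional \<phi> (r b)" and "r 1 1 = 1"
    and "\<And>x. finite {b. r b x \<noteq> 0}" and "\<And>x. (\<Sum>b | r b x \<noteq> 0. \<phi> (r b x) * b) = x"
proof -
  have \<phi>: "\<phi> 1 = 1" "\<And>x y. \<phi> (x + y) = \<phi> x + \<phi> y" "\<And>x y. \<phi> (x * y) = \<phi> x * \<phi> y"
    using assms unfolding field_embedding_def by blast+
  interpret L: vector_space "\<lambda>c x. \<phi> c * x"
    by unfold_locales (simp_all only: \<phi> distrib_left distrib_right mult.assoc mult_1_left)
  have one: "L.independent {1}" by simp
  define B where "B = L.extend_basis {1}"
  have B: "L.independent B" "L.span B = UNIV" "1 \<in> B"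
    using L.independent_extend_basis[OF one] L.span_extend_basis[OF one]
      L.extend_basis_superset[OF one] by (auto simp: B_def)
  show thesis
  proof (rule that[of "\<lambda>b x. L.representation B x b"])
    show "linear_functional \<phi> (\<lambda>x. L.representation B x b)" for b
      using B by (simp add: linear_functional_def additive_def L.representation_add
        L.representation_scale)
    show "L.representation B 1 1 = 1"
      using B by (simp add: L.representation_basis)
    show "finite {b. L.representation B x b \<noteq> 0}" for x
      by (rule L.finite_representation)
    show "(\<Sum>b | L.representation B x b \<noteq> 0. \<phi> (L.representation B x b) * b) = x" for x
      using B by (intro L.sum_nonzero_representation_eq) auto
  qed
qed

text \<open>The coordinate of the basis element 1.\<close>

lemma normalized_functional:
  assumes "field_embedding \<phi>"
  obtains l where "linear_functional \<phi> l" and "l 1 = 1"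
  by (rule coordinate_functionals[OF assms]) (rule that)

lemma map_functional_mem:
  assumes \<phi>: "field_embedding \<phi>" and I: "is_ideal I"
    and h: "h \<in> extend_ideal \<phi> I" and l: "linear_functional \<phi> l"
  shows "Poly_Mapping.map l h \<in> I"
  using h unfolding extend_ideal_def
proof (induction rule: ideal.span_induct_alt)
  case base
  show ?case using ideal.subspace_0[OF I] by (simp add: map_zero_poly_mapping)
next
  case (step c x y)
  from step.hyps obtain p where p: "p \<in> I" "x = extend_poly \<phi> p" by auto
  have "additive l" using l by (simp add: linear_functional_def)
  then have "Poly_Mapping.map l (c * x + y) = Poly_Mapping.map l c * p + Poly_Mapping.map l y"
    using map_functional_mult_extend_poly[OF \<phi> l, of p c]
    by (simp add: p map_add_poly_mapping mult.commute)
  then show ?case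
    using ideal.subspace_add[OF I] ideal.subspace_scale[OF I] p step.IH by simp
qed

text \<open>
  For the converse inclusion, \<open>h\<close> is the sum of the polynomials $b \cdot (\lambda_b)_* h$ over the basis
  elements \<open>b\<close>, where $\lambda_b$ is the coordinate functional of \<open>b\<close>. The sum is finite because \<open>h\<close>
  has only finitely many coefficients.
\<close>

lemma mem_extend_ideal_iff:
  assumes \<phi>: "field_embedding \<phi>" and I: "is_ideal I"
  shows "h \<in> extend_ideal \<phi> I \<longleftrightarrow> (\<forall>l. linear_functional \<phi> l \<longrightarrow> Poly_Mapping.map l h \<in> I)"
proof
  assume "h \<in> extend_ideal \<phi> I"
  then show "\<forall>l. linear_functional \<phi> l \<longrightarrow> Poly_Mapping.map l h \<in> I"
    using map_functional_mem[OF \<phi> I] by blast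
next
  assume mem: "\<forall>l. linear_functional \<phi> l \<longrightarrow> Poly_Mapping.map l h \<in> I"
  obtain r where lin: "\<And>b. linear_functional \<phi> (r b)" and "r 1 1 = 1"
    and fin: "\<And>x. finite {b. r b x \<noteq> 0}"
    and expand: "\<And>x. (\<Sum>b | r b x \<noteq> 0. \<phi> (r b x) * b) = x"
    by (rule coordinate_functionals[OF \<phi>]) (rule that)
  have r0: "r b 0 = 0" for b
    using lin[of b] by (simp add: linear_functional_def additive.zero)
  have \<phi>0: "\<phi> 0 = 0"
    by (rule additive.zero[OF field_embedding_additive[OF \<phi>]])
  define S where "S = (\<Union>k\<in>Poly_Mapping.keys h. {b. r b (Poly_Mapping.lookup h k) \<noteq> 0})"
  have "finite S" by (simp add: S_def fin)
  have "(\<Sum>b\<in>S. Const b * extend_poly \<phi> (Poly_Mapping.map (r b) h)) = h"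
  proof (rule poly_mapping_eqI)
    fix k
    let ?x = "Poly_Mapping.lookup h k"
    have "{b. r b ?x \<noteq> 0} \<subseteq> S"
      using r0 by (cases "k \<in> Poly_Mapping.keys h") (auto simp: S_def in_keys_iff)
    with \<open>finite S\<close> have "(\<Sum>b\<in>S. \<phi> (r b ?x) * b) = (\<Sum>b | r b ?x \<noteq> 0. \<phi> (r b ?x) * b)"
      by (intro sum.mono_neutral_right) (auto simp: \<phi>0)
    also have "\<dots> = ?x" by (rule expand)
    finally show "Poly_Mapping.lookup
        (\<Sum>b\<in>S. Const b * extend_poly \<phi> (Poly_Mapping.map (r b) h)) k = ?x"
      by (simp add: lookup_sum lookup_Const_mult lookup_map_zero \<phi>0 r0 mult.commute)
  qed
  moreover have "(\<Sum>b\<in>S. Const b * extend_poly \<phi> (Poly_Mapping.map (r b) h)) \<in> extend_ideal \<phi> I"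
    unfolding extend_ideal_def
    using mem lin by (intro ideal.span_sum ideal.span_scale ideal.span_base imageI) blast
  ultimately show "h \<in> extend_ideal \<phi> I" by simp
qed

lemma extend_ideal_proper:
  fixes \<phi> :: "'a::field \<Rightarrow> 'b::field" and I :: "('n, 'a) mpoly set"
  assumes \<phi>: "field_embedding \<phi>" and I: "is_ideal I" and "1 \<notin> I"
  shows "1 \<notin> extend_ideal \<phi> I"
proof
  assume mem: "1 \<in> extend_ideal \<phi> I"
  obtain l where l: "linear_functional \<phi> l" "l 1 = 1"
    by (rule normalized_functional[OF \<phi>])
  have "l 0 = 0" using l(1) by (simp add: linear_functional_def additive.zero)
  then have "Poly_Mapping.map l (1 :: ('n, 'b) mpoly) = 1" by (simp add: map_one_poly_mapping l(2))
  with map_functional_mem[OF \<phi> I mem l(1)] \<open>1 \<notin> I\<close> show False by simp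
qed

text \<open>
  If $f g \in I L[X]$ with $f \in K[X]$, then $f \cdot \lambda_* g = \lambda_* (f g) \in I$ for every
  functional $\lambda$, whence $\lambda_* g \in I$. Thus multiplication by \<open>f\<close> remains injective after the
  flat base change from \<open>K\<close> to \<open>L\<close>.
\<close>

lemma nonzerodivisor_mod_extend:
  assumes \<phi>: "field_embedding \<phi>" and I: "is_ideal I" and f: "nonzerodivisor_mod I f"
  shows "nonzerodivisor_mod (extend_ideal \<phi> I) (extend_poly \<phi> f)"
  unfolding nonzerodivisor_mod_def
proof (intro allI impI)
  fix g
  assume "extend_poly \<phi> f * g \<in> extend_ideal \<phi> I"
  then have "f * Poly_Mapping.map l g \<in> I" if "linear_functional \<phi> l" for l
    using map_functional_mem[OF \<phi> I _ that] map_functional_mult_extend_poly[OF \<phi> that]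
    by metis
  then show "g \<in> extend_ideal \<phi> I"
    using f unfolding nonzerodivisor_mod_def mem_extend_ideal_iff[OF \<phi> I] by blast
qed

section \<open>Unit lattices and their characters\<close>

lemma ideal_eq_UNIV_iff:
  assumes "is_ideal J"
  shows "J = UNIV \<longleftrightarrow> 1 \<in> J"
proof
  assume "1 \<in> J"
  have "c \<in> J" for c
    using ideal.subspace_scale[OF assms \<open>1 \<in> J\<close>, of c] by (simp only: mult_1_right)
  then show "J = UNIV" by blast
qed simp

lemma nonzerodivisor_mod_tuple_power:
  assumes "\<And>i. nonzerodivisor_mod J (F $ i)"
  shows "nonzerodivisor_mod J (tuple_power F b)"
proof -
  have mult: "nonzerodivisor_mod J (f * g)"
    if "nonzerodivisor_mod J f" "nonzerodivisor_mod J g" for f g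
    using that unfolding nonzerodivisor_mod_def mult.assoc by blast
  have one: "nonzerodivisor_mod J 1" by (simp add: nonzerodivisor_mod_def)
  have power: "nonzerodivisor_mod J (F $ i ^ m)" for i m
    by (induction m) (simp_all add: one mult assms)
  have "nonzerodivisor_mod J (\<Prod>i\<in>S. (F $ i) ^ (b $ i))" if "finite S" for S
    using that by (induction S) (simp_all add: one mult power)
  then show ?thesis by (simp add: tuple_power_def)
qed

lemma tuple_power_notin_ideal:
  assumes "admits_unit_lattice J F"
  shows "tuple_power F b \<notin> J"
proof
  assume "tuple_power F b \<in> J"
  moreover have "nonzerodivisor_mod J (tuple_power F b)"
    using assms by (intro nonzerodivisor_mod_tuple_power) (simp add: admits_unit_lattice_def)
  ultimately have "1 \<in> J"
    unfolding nonzerodivisor_mod_def by (metis mult.right_neutral)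
  with assms show False unfolding admits_unit_lattice_def using ideal_eq_UNIV_iff by blast
qed

lemma unit_relation_nonzero:
  assumes "admits_unit_lattice J F"
    and "tuple_power F b - Const g * tuple_power F c \<in> J"
  shows "g \<noteq> 0"
proof
  assume "g = 0"
  with assms(2) have "tuple_power F b \<in> J"
    by (simp only: single_zero mult_zero_left diff_zero)
  with tuple_power_notin_ideal[OF assms(1)] show False by contradiction
qed

text \<open>
  The difference of two relations is $(g' - g) F^c \in J$. If $g' - g$ were invertible, a power of \<open>F\<close>
  would lie in \<open>J\<close>.
\<close>

lemma unit_relation_unique:
  fixes F :: "('n, 'a::field) mpoly ^ 'k::finite"
  assumes adm: "admits_unit_lattice J F"
    and g: "tuple_power F b - Const g * tuple_power F c \<in> J"
    and g': "tuple_power F b - Const g' * tuple_power F c \<in> J"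
  shows "g = g'"
proof (rule ccontr)
  assume "g \<noteq> g'"
  let ?M = "tuple_power F c"
  have J: "is_ideal J" using adm by (simp add: admits_unit_lattice_def)
  have "Const (g' - g) * ?M
      = (tuple_power F b - Const g * ?M) - (tuple_power F b - Const g' * ?M)"
    by (simp add: single_diff algebra_simps)
  with ideal.subspace_diff[OF J g g'] have "Const (g' - g) * ?M \<in> J" by simp
  then have "Const (inverse (g' - g)) * (Const (g' - g) * ?M) \<in> J"
    by (rule ideal.subspace_scale[OF J])
  moreover have "Const (inverse (g' - g)) * (Const (g' - g) * ?M) = ?M"
    using \<open>g \<noteq> g'\<close> by (simp add: mult_single flip: mult.assoc)
  ultimately show False using tuple_power_notin_ideal[OF adm] by simp
qed

lemma unit_character_eqI:
  assumes adm: "admits_unit_lattice J F"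
    and g: "tuple_power F (pos_part a) - Const g * tuple_power F (neg_part a) \<in> J"
  shows "unit_character J F a = g"
  unfolding unit_character_def
proof (rule the_equality)
  show "g \<noteq> 0 \<and> tuple_power F (pos_part a) - Const g * tuple_power F (neg_part a) \<in> J"
    using unit_relation_nonzero[OF adm g] g by (rule conjI)
qed (blast intro: unit_relation_unique[OF adm _ g])

lemma unit_character_relation:
  assumes "admits_unit_lattice J F" and "a \<in> unit_lattice J F"
  shows "tuple_power F (pos_part a) - Const (unit_character J F a) * tuple_power F (neg_part a) \<in> J"
proof -
  from assms(2) obtain g
    where g: "tuple_power F (pos_part a) - Const g * tuple_power F (neg_part a) \<in> J"
    unfolding unit_lattice_def by blast
  then show ?thesis by (simp only: unit_character_eqI[OF assms(1) g])
qed

text \<open>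
  The quotient condition says that the product of the $f_i$ is a non-zerodivisor modulo \<open>I\<close>, and a
  factor of a non-zerodivisor is a non-zerodivisor.
\<close>

lemma nonzerodivisor_mod_of_quotient:
  fixes F :: "'r::comm_ring_1 ^ 'k::finite"
  assumes I: "is_ideal I"
    and quot: "ideal_quotient I (ideal_generated {\<Prod>i\<in>UNIV. F $ i}) = I"
  shows "nonzerodivisor_mod I (F $ i)"
  unfolding nonzerodivisor_mod_def
proof (intro allI impI)
  fix g
  assume fg: "F $ i * g \<in> I"
  have "g * h \<in> I" if h: "h \<in> ideal_generated {\<Prod>i\<in>UNIV. F $ i}" for h
  proof -
    from h obtain c where c: "h = c * (\<Prod>i\<in>UNIV. F $ i)"
      unfolding ideal.span_singleton by blast
    have "(\<Prod>i\<in>UNIV. F $ i) = F $ i * (\<Prod>j\<in>UNIV - {i}. F $ j)"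
      by (rule prod.remove) simp_all
    then have "g * h = (c * (\<Prod>j\<in>UNIV - {i}. F $ j)) * (F $ i * g)"
      unfolding c by (simp only: mult_ac)
    with ideal.subspace_scale[OF I fg] show ?thesis by (simp only:)
  qed
  then have "g \<in> ideal_quotient I (ideal_generated {\<Prod>i\<in>UNIV. F $ i})"
    by (simp add: ideal_quotient_def)
  with quot show "g \<in> I" by simp
qed

lemma admits_unit_lattice_extend:
  assumes \<phi>: "field_embedding \<phi>" and adm: "admits_unit_lattice I F"
  shows "admits_unit_lattice (extend_ideal \<phi> I) (extend_tuple \<phi> F)"
proof -
  have I: "is_ideal I" "1 \<notin> I" and F: "\<And>i. nonzerodivisor_mod I (F $ i)"
    using adm ideal_eq_UNIV_iff[of I] unfolding admits_unit_lattice_def by blast+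
  have "is_ideal (extend_ideal \<phi> I)"
    unfolding extend_ideal_def by (rule ideal.subspace_span)
  with extend_ideal_proper[OF \<phi> I] show ?thesis
    by (simp add: admits_unit_lattice_def ideal_eq_UNIV_iff extend_tuple_def
        nonzerodivisor_mod_extend[OF \<phi> I(1) F])
qed

lemma extend_unit_relation:
  assumes \<phi>: "field_embedding \<phi>"
    and g: "tuple_power F b - Const g * tuple_power F c \<in> I"
  shows "tuple_power (extend_tuple \<phi> F) b - Const (\<phi> g) * tuple_power (extend_tuple \<phi> F) c
    \<in> extend_ideal \<phi> I"
proof -
  note add = field_embedding_additive[OF \<phi>]
  have "tuple_power (extend_tuple \<phi> F) b - Const (\<phi> g) * tuple_power (extend_tuple \<phi> F) c
      = extend_poly \<phi> (tuple_power F b - Const g * tuple_power F c)"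
    by (simp add: extend_poly_tuple_power[OF \<phi>] map_diff_poly_mapping[OF add]
        extend_poly_mult[OF \<phi>] additive.zero[OF add])
  with g show ?thesis unfolding extend_ideal_def by (simp add: ideal.span_base)
qed

text \<open>
  A functional with $\lambda(1) = 1$ satisfies $\lambda_* p = p$ for $p \in K[X]$, so it carries the
  relation with scalar \<open>g\<close> to one with scalar $\lambda(g)$.
\<close>

lemma descend_unit_relation:
  assumes \<phi>: "field_embedding \<phi>" and I: "is_ideal I"
    and g: "tuple_power (extend_tuple \<phi> F) b - Const g * tuple_power (extend_tuple \<phi> F) c
      \<in> extend_ideal \<phi> I"
  obtains g' where "tuple_power F b - Const g' * tuple_power F c \<in> I"
proof -
  obtain l where l: "linear_functional \<phi> l" "l 1 = 1"
    by (rule normalized_functional[OF \<phi>])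
  then have add: "additive l" by (simp add: linear_functional_def)
  note l0 = additive.zero[OF add]
  have const: "Poly_Mapping.map l (extend_poly \<phi> p * Const x) = p * Const (l x)" for p x
    by (simp add: map_functional_mult_extend_poly[OF \<phi> l(1)] l0)
  have "Poly_Mapping.map l (extend_poly \<phi> p) = p" for p
    using const[of p 1] by (simp add: l)
  then have "Poly_Mapping.map l (tuple_power (extend_tuple \<phi> F) b
        - Const g * tuple_power (extend_tuple \<phi> F) c)
      = tuple_power F b - Const (l g) * tuple_power F c"
    by (simp add: extend_poly_tuple_power[OF \<phi>] map_diff_poly_mapping[OF add] const
        mult.commute[of "Const _"])
  with map_functional_mem[OF \<phi> I g l(1)] show thesis by (intro that[of "l g"]) simp
qed

theorem proposition4p11:
  fixes \<phi> :: "'K::field \<Rightarrow> 'L::field"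
    and F :: "('n::finite, 'K) mpoly ^ 'k::finite"
    and I :: "('n, 'K) mpoly set"
  assumes "field_embedding \<phi>"
    and "is_ideal I" and "I \<noteq> UNIV"
    and "ideal_quotient I (ideal_generated {\<Prod>i\<in>UNIV. F $ i}) = I"
  shows "admits_unit_lattice I F
    \<and> admits_unit_lattice (extend_ideal \<phi> I) (extend_tuple \<phi> F)
    \<and> unit_lattice I F = unit_lattice (extend_ideal \<phi> I) (extend_tuple \<phi> F)
    \<and> (\<forall>a\<in>unit_lattice I F.
          \<phi> (unit_character I F a)
            = unit_character (extend_ideal \<phi> I) (extend_tuple \<phi> F) a)"
proof -
  let ?J = "extend_ideal \<phi> I" and ?G = "extend_tuple \<phi> F"
  have adm: "admits_unit_lattice I F"
    using assms nonzerodivisor_mod_of_quotient[OF assms(2,4)]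
    by (simp add: admits_unit_lattice_def)
  note adm' = admits_unit_lattice_extend[OF assms(1) adm]
  have char: "\<phi> (unit_character I F a) = unit_character ?J ?G a" if "a \<in> unit_lattice I F" for a
    using extend_unit_relation[OF assms(1) unit_character_relation[OF adm that]]
    by (rule unit_character_eqI[OF adm', symmetric])
  have "unit_lattice I F \<subseteq> unit_lattice ?J ?G"
  proof
    fix a assume "a \<in> unit_lattice I F"
    note rel = extend_unit_relation[OF assms(1) unit_character_relation[OF adm this]]
    with unit_relation_nonzero[OF adm' rel] show "a \<in> unit_lattice ?J ?G"
      unfolding unit_lattice_def by blast
  qed
  moreover have "unit_lattice ?J ?G \<subseteq> unit_lattice I F"
  proof
    fix a assume "a \<in> unit_lattice ?J ?G"
    then obtain g where "tuple_power ?G (pos_part a) - Const g * tuple_power ?G (neg_part a) \<in> ?J"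
      by (auto simp: unit_lattice_def)
    then obtain g' where rel: "tuple_power F (pos_part a) - Const g' * tuple_power F (neg_part a) \<in> I"
      by (rule descend_unit_relation[OF assms(1,2)])
    with unit_relation_nonzero[OF adm rel] show "a \<in> unit_lattice I F"
      unfolding unit_lattice_def by blast
  qed
  ultimately show ?thesis using adm adm' char by blast
qed

end
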